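(* The full symmetric group $\mathrm{Sym}(\mathbb{N})$ embeds as a topological group into $\mathrm{Aut}(\mathbf{F})$, where both groups carry the topology of pointwise convergence and $\mathbf{F}$ is the countable universal homogeneous echeloned space.
   Context: An echeloned space is a pair $(X,\leq_\mathbf{X})$ where $X$ is a non-empty set and $\leq_\mathbf{X}$ is a total preorder on $X^2$ such that for all $x,y,z$: $(x,x)\leq_\mathbf{X}(y,z)$; $(y,z)\leq_\mathbf{X}(x,x)$ implies $y=z$; $(x,y)\leq_\mathbf{X}(y,x)$. Embeddings are injective maps $h$ with $(x_1,y_1)\leq_\mathbf{X}(x_2,y_2)\iff(h(x_1),h(y_1))\leq_\mathbf{Y}(h(x_2),h(y_2))$; automorphisms are bijective embeddings of a space onto itself. $\mathbf{F}$ is the Fraïssé limit of the class of finite echeloned spaces: the unique countable echeloned space that is homogeneous (every isomorphism between finite substructures extends to an automorphism) and into which every finite echeloned space embeds. $\mathrm{Aut}(\mathbf{F})\leq\mathrm{Sym}(F)$ carries the topology of pointwise convergence (with $F$ discrete). *)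

theory Defs
  imports "HOL-Algebra.Bij" "HOL-Analysis.Function_Topology"
begin

section \<open>Echeloned spaces\<close>

text \<open>The order is a relation on pairs: \<open>((x, y), (z, w)) \<in> r\<close> means
  \<open>(x, y) \<le> (z, w)\<close>. Totality on distinct elements together with reflexivity (contained in
  \<^const>\<open>preorder_on\<close>) gives comparability of any two pairs.\<close>

locale echeloned_space =
  fixes X :: "'a set" and r :: "('a \<times> 'a) rel"
  assumes nonempty: "X \<noteq> {}"
    and preorder: "preorder_on (X \<times> X) r"
    and total: "total_on (X \<times> X) r"
    and diag_least: "\<lbrakk>x \<in> X; y \<in> X; z \<in> X\<rbrakk> \<Longrightarrow> ((x, x), (y, z)) \<in> r"
    and diag_only_least: "\<lbrakk>x \<in> X; y \<in> X; z \<in> X; ((y, z), (x, x)) \<in> r\<rbrakk> \<Longrightarrow> y = z"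
    and symmetric: "\<lbrakk>x \<in> X; y \<in> X\<rbrakk> \<Longrightarrow> ((x, y), (y, x)) \<in> r"

definition ech_embedding ::
    "'a set \<Rightarrow> ('a \<times> 'a) rel \<Rightarrow> 'b set \<Rightarrow> ('b \<times> 'b) rel \<Rightarrow> ('a \<Rightarrow> 'b) \<Rightarrow> bool"
  where "ech_embedding X r Y s h \<longleftrightarrow>
    h \<in> X \<rightarrow> Y \<and> inj_on h X \<and>
    (\<forall>x1\<in>X. \<forall>y1\<in>X. \<forall>x2\<in>X. \<forall>y2\<in>X.
      ((x1, y1), (x2, y2)) \<in> r \<longleftrightarrow> ((h x1, h y1), (h x2, h y2)) \<in> s)"

definition ech_iso ::
    "'a set \<Rightarrow> ('a \<times> 'a) rel \<Rightarrow> 'b set \<Rightarrow> ('b \<times> 'b) rel \<Rightarrow> ('a \<Rightarrow> 'b) \<Rightarrow> bool"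
  where "ech_iso X r Y s h \<longleftrightarrow> ech_embedding X r Y s h \<and> h ` X = Y"

definition ech_restrict :: "('a \<times> 'a) rel \<Rightarrow> 'a set \<Rightarrow> ('a \<times> 'a) rel"
  where "ech_restrict r A = Restr r (A \<times> A)"

lemma ech_restrict_space:
  assumes "echeloned_space X r" "A \<subseteq> X" "A \<noteq> {}"
  shows "echeloned_space A (ech_restrict r A)"
proof -
  interpret echeloned_space X r by fact
  have "trans r" "refl_on (X \<times> X) r" using preorder by (auto simp: preorder_on_def)
  then have "preorder_on (A \<times> A) (ech_restrict r A)"
    using \<open>A \<subseteq> X\<close> by (auto simp: preorder_on_def refl_on_def ech_restrict_def trans_Restr)
  moreover have "total_on (A \<times> A) (ech_restrict r A)"
    using total \<open>A \<subseteq> X\<close> unfolding total_on_def ech_restrict_def by blast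
  moreover have "y = z" if "x \<in> A" "y \<in> A" "z \<in> A" "((y, z), (x, x)) \<in> ech_restrict r A" for x y z
    using that \<open>A \<subseteq> X\<close> diag_only_least[of x y z] by (simp add: ech_restrict_def subsetD)
  moreover have "((x, x), (y, z)) \<in> ech_restrict r A" if "x \<in> A" "y \<in> A" "z \<in> A" for x y z
    using that \<open>A \<subseteq> X\<close> diag_least[of x y z] by (simp add: ech_restrict_def subsetD)
  moreover have "((x, y), (y, x)) \<in> ech_restrict r A" if "x \<in> A" "y \<in> A" for x y
    using that \<open>A \<subseteq> X\<close> symmetric[of x y] by (simp add: ech_restrict_def subsetD)
  ultimately show ?thesis
    using \<open>A \<noteq> {}\<close> by (intro echeloned_space.intro)
qed

section \<open>The automorphism group\<close>

text \<open>\<^const>\<open>Bij\<close> consists of the bijections of \<open>X\<close> onto itself that are extensional,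
  so that distinct elements are distinct permutations of \<open>X\<close>.\<close>

definition ech_Aut :: "'a set \<Rightarrow> ('a \<times> 'a) rel \<Rightarrow> ('a \<Rightarrow> 'a) set"
  where "ech_Aut X r = {g \<in> Bij X. ech_embedding X r X r g}"

definition ech_AutGroup :: "'a set \<Rightarrow> ('a \<times> 'a) rel \<Rightarrow> ('a \<Rightarrow> 'a) monoid"
  where "ech_AutGroup X r = (BijGroup X) \<lparr>carrier := ech_Aut X r\<rparr>"

lemma subgroup_ech_Aut: "subgroup (ech_Aut X r) (BijGroup X)"
proof
  show "ech_Aut X r \<subseteq> carrier (BijGroup X)"
    by (auto simp: ech_Aut_def BijGroup_def)
  show "\<one>\<^bsub>BijGroup X\<^esub> \<in> ech_Aut X r"
    by (auto simp: ech_Aut_def BijGroup_def id_Bij ech_embedding_def inj_on_def)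
next
  fix g h assume gh: "g \<in> ech_Aut X r" "h \<in> ech_Aut X r"
  then have B: "g \<in> Bij X" "h \<in> Bij X" by (auto simp: ech_Aut_def)
  have "compose X g h \<in> Bij X" using B by (rule compose_Bij)
  moreover have "ech_embedding X r X r (compose X g h)"
    using gh \<open>compose X g h \<in> Bij X\<close> 
    by (auto simp: ech_Aut_def ech_embedding_def compose_def Bij_def bij_betw_def Pi_iff)
  ultimately show "g \<otimes>\<^bsub>BijGroup X\<^esub> h \<in> ech_Aut X r"
    using B by (simp add: ech_Aut_def BijGroup_def)
next
  fix g assume g: "g \<in> ech_Aut X r"
  define k where "k = (\<lambda>x\<in>X. inv_into X g x)"
  have B: "g \<in> Bij X" and e: "ech_embedding X r X r g" using g by (auto simp: ech_Aut_def)
  have k: "k \<in> Bij X" unfolding k_def using B by (rule restrict_inv_into_Bij)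
  have gk: "\<And>x. x \<in> X \<Longrightarrow> k x \<in> X \<and> g (k x) = x"
    using B by (auto simp: k_def Bij_def bij_betw_def inv_into_into f_inv_into_f)
  have "ech_embedding X r X r k"
    unfolding ech_embedding_def
  proof (intro conjI ballI)
    show "k \<in> X \<rightarrow> X" using gk by auto
    show "inj_on k X" using k by (auto simp: Bij_def bij_betw_def)
    fix a b c d assume X: "a \<in> X" "b \<in> X" "c \<in> X" "d \<in> X"
    have "((k a, k b), (k c, k d)) \<in> r \<longleftrightarrow>
      ((g (k a), g (k b)), (g (k c), g (k d))) \<in> r"
      using e gk[OF X(1)] gk[OF X(2)] gk[OF X(3)] gk[OF X(4)]
      unfolding ech_embedding_def by blast
    also have "\<dots> \<longleftrightarrow> ((a, b), (c, d)) \<in> r"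
      using gk[OF X(1)] gk[OF X(2)] gk[OF X(3)] gk[OF X(4)] by argo
    finally show "((a, b), (c, d)) \<in> r \<longleftrightarrow> ((k a, k b), (k c, k d)) \<in> r" by argo
  qed
  then show "inv\<^bsub>BijGroup X\<^esub> g \<in> ech_Aut X r"
    using k B by (simp add: ech_Aut_def inv_BijGroup k_def)
qed

section \<open>The countable universal homogeneous echeloned space\<close>

text \<open>Universality is stated for finite spaces with points in \<^typ>\<open>nat\<close>, since a locale
  assumption cannot quantify over types; \<open>universal_finite\<close> below extends it to finite spaces over
  every type. By uniqueness of the Fraisse limit, the models of this locale are exactly the
  isomorphic copies of \<open>\<^bold>F\<close>.\<close>

locale universal_homogeneous_echeloned_space = echeloned_space X r
  for X :: "'a set" and r :: "('a \<times> 'a) rel" +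
  assumes countable: "countable X"
    and homogeneous:
      "\<lbrakk>A \<subseteq> X; finite A; A \<noteq> {}; B \<subseteq> X; finite B; B \<noteq> {};
        ech_iso A (ech_restrict r A) B (ech_restrict r B) h\<rbrakk>
       \<Longrightarrow> \<exists>g \<in> ech_Aut X r. \<forall>x\<in>A. g x = h x"
    and universal_nat:
      "\<lbrakk>finite (Y :: nat set); echeloned_space Y s\<rbrakk> \<Longrightarrow> \<exists>h. ech_embedding Y s X r h"

lemma (in universal_homogeneous_echeloned_space) universal_finite:
  fixes Y :: "'b set"
  assumes "finite Y" "echeloned_space Y s"
  shows "\<exists>h. ech_embedding Y s X r h"
proof -
  interpret Y: echeloned_space Y s by fact
  obtain f :: "'b \<Rightarrow> nat" where f: "inj_on f Y"
    using finite_imp_inj_to_nat_seg[OF \<open>finite Y\<close>] by blast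
  define k where "k = inv_into Y f"
  define Z where "Z = f ` Y"
  have k: "\<And>z. z \<in> Z \<Longrightarrow> k z \<in> Y" "inj_on k Z" "\<And>y. y \<in> Y \<Longrightarrow> k (f y) = y"
    using f by (auto simp: k_def Z_def inv_into_into inj_on_inv_into)
  define t where "t = {((a, b), (c, d)). a \<in> Z \<and> b \<in> Z \<and> c \<in> Z \<and> d \<in> Z \<and>
    ((k a, k b), (k c, k d)) \<in> s}"
  have s: "refl_on (Y \<times> Y) s" "trans s"
    using Y.preorder by (auto simp: preorder_on_def)
  have "preorder_on (Z \<times> Z) t"
    unfolding preorder_on_def
  proof (intro conjI)
    show "t \<subseteq> (Z \<times> Z) \<times> (Z \<times> Z)" by (auto simp: t_def)
    show "refl_on (Z \<times> Z) t" using s(1) k(1) by (auto simp: t_def refl_on_def)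
    show "trans t" using s(2) unfolding trans_def t_def by blast
  qed
  moreover have "total_on (Z \<times> Z) t"
    unfolding total_on_def
  proof (intro ballI impI)
    fix p q assume pq: "p \<in> Z \<times> Z" "q \<in> Z \<times> Z" "p \<noteq> q"
    obtain a b c d where [simp]: "p = (a, b)" "q = (c, d)" by (metis surj_pair)
    have "(k a, k b) \<noteq> (k c, k d)" using pq k(2) by (auto simp: inj_on_def)
    then show "(p, q) \<in> t \<or> (q, p) \<in> t"
      using Y.total pq k(1) by (auto simp: total_on_def t_def)
  qed
  moreover have "b = c" if "a \<in> Z" "b \<in> Z" "c \<in> Z" "((b, c), (a, a)) \<in> t" for a b c
    using that Y.diag_only_least[OF k(1) k(1) k(1)] inj_onD[OF k(2)] by (auto simp: t_def)
  moreover have "Z \<noteq> {}" using Y.nonempty by (simp add: Z_def)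
  ultimately have "echeloned_space Z t"
    using Y.diag_least Y.symmetric k(1) by unfold_locales (auto simp: t_def)
  moreover have "finite Z" using \<open>finite Y\<close> by (simp add: Z_def)
  ultimately obtain h where h: "ech_embedding Z t X r h" using universal_nat by blast
  have "ech_embedding Y s X r (h \<circ> f)"
    unfolding ech_embedding_def
  proof (intro conjI ballI)
    show "h \<circ> f \<in> Y \<rightarrow> X" using h by (auto simp: ech_embedding_def Z_def)
    show "inj_on (h \<circ> f) Y"
      using h f by (auto simp: ech_embedding_def Z_def intro: comp_inj_on)
    fix a b c d assume Y: "a \<in> Y" "b \<in> Y" "c \<in> Y" "d \<in> Y"
    have "((a, b), (c, d)) \<in> s \<longleftrightarrow> ((f a, f b), (f c, f d)) \<in> t"
      using Y by (simp add: t_def k(3) Z_def)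
    also have "\<dots> \<longleftrightarrow> ((h (f a), h (f b)), (h (f c), h (f d))) \<in> r"
      using h Y by (simp add: ech_embedding_def Z_def)
    finally show "((a, b), (c, d)) \<in> s \<longleftrightarrow>
      (((h \<circ> f) a, (h \<circ> f) b), ((h \<circ> f) c, (h \<circ> f) d)) \<in> r" by simp
  qed
  then show ?thesis by blast
qed

section \<open>Pointwise convergence and embeddings of topological groups\<close>

definition pointwise_topology :: "'a set \<Rightarrow> ('a \<Rightarrow> 'a) set \<Rightarrow> ('a \<Rightarrow> 'a) topology"
  where "pointwise_topology X G = subtopology (product_topology (\<lambda>_. discrete_topology X) X) G"

lemma topspace_pointwise_topology:
  assumes "G \<subseteq> Bij X"
  shows "topspace (pointwise_topology X G) = G"
  using assms by (auto simp: pointwise_topology_def Bij_def bij_betw_def PiE_def Pi_iff)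

text \<open>\<^const>\<open>embedding_map\<close> requires a homeomorphism onto the image with its subspace topology,
  and hence includes injectivity.\<close>

definition topological_group_embedding ::
    "('a, 'm) monoid_scheme \<Rightarrow> 'a topology \<Rightarrow> ('b, 'n) monoid_scheme \<Rightarrow> 'b topology
      \<Rightarrow> ('a \<Rightarrow> 'b) \<Rightarrow> bool"
  where "topological_group_embedding G S H T \<phi> \<longleftrightarrow> \<phi> \<in> hom G H \<and> embedding_map S T \<phi>"

end

theory Submission
  imports Defs
begin

text \<open>Colour each pair of points of \<open>\<^bold>F\<close> by its class in the preorder. Homogeneity and universality
  give an extension property: every colouring of a finite set of points by classes of pairs of
  distinct points is realised by a further point, because those classes already occur in a larger
  finite subspace. By back-and-forth, a countable edge-coloured complete graph with this property is
  determined by its set of colours. Another such graph is freely generated over \<open>\<nat>\<close>: each finite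
  partial colouring of the points constructed so far becomes a new point, and a default colour is
  used elsewhere. Permutations of \<open>\<nat>\<close> act on it by renaming, each point involves only finitely many
  generators, and the generators are themselves points; hence the action is a topological
  embedding.\<close>

section \<open>Edge-coloured graphs with the extension property\<close>

text \<open>An analogue of the random graph, with the elements of \<open>C\<close> as edge colours.
  The diagonal values of \<open>c\<close> carry no information, and \<open>extension\<close> with
  \<open>A = {}\<close> makes \<open>X\<close> nonempty.\<close>

locale extensible_colouring =
  fixes X :: "'a set" and C :: "'c set" and c :: "'a \<Rightarrow> 'a \<Rightarrow> 'c"
  assumes countable_points: "countable X"
    and colour_sym: "\<lbrakk>x \<in> X; y \<in> X\<rbrakk> \<Longrightarrow> c x y = c y x"
    and colour_in: "\<lbrakk>x \<in> X; y \<in> X; x \<noteq> y\<rbrakk> \<Longrightarrow> c x y \<in> C"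
    and extension: "\<lbrakk>finite A; A \<subseteq> X; f \<in> A \<rightarrow> C\<rbrakk> \<Longrightarrow> \<exists>x\<in>X - A. \<forall>a\<in>A. c x a = f a"

section \<open>Back-and-forth between extensible colourings\<close>

definition partial_colour_iso ::
    "'a set \<Rightarrow> ('a \<Rightarrow> 'a \<Rightarrow> 'c) \<Rightarrow> 'b set \<Rightarrow> ('b \<Rightarrow> 'b \<Rightarrow> 'c) \<Rightarrow> ('a \<times> 'b) set \<Rightarrow> bool"
  where "partial_colour_iso X c Y d P \<longleftrightarrow> finite P \<and> P \<subseteq> X \<times> Y \<and>
    (\<forall>(x, y)\<in>P. \<forall>(x', y')\<in>P. (x = x' \<longleftrightarrow> y = y') \<and> (x \<noteq> x' \<longrightarrow> c x x' = d y y'))"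

lemma partial_colour_isoD:
  assumes "partial_colour_iso X c Y d P" "(x, y) \<in> P" "(x', y') \<in> P"
  shows "x = x' \<longleftrightarrow> y = y'" "x \<noteq> x' \<Longrightarrow> c x x' = d y y'"
  using assms unfolding partial_colour_iso_def by blast+

text \<open>Partial isomorphisms are encoded as relations so that this symmetry turns the back step
  into a forth step.\<close>

lemma partial_colour_iso_converse:
  assumes "partial_colour_iso X c Y d P"
  shows "partial_colour_iso Y d X c (P\<inverse>)"
  using assms unfolding partial_colour_iso_def by fastforce

text \<open>The colours from \<open>x\<close> to the domain of \<open>P\<close> are carried along
  \<open>P\<close> to a colouring of its range. A new point of \<open>Y\<close> realising that
  colouring can be matched with \<open>x\<close>.\<close>

lemma partial_colour_iso_forth:
  assumes "extensible_colouring X C c" "extensible_colouring Y C d"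
    and P: "partial_colour_iso X c Y d P" and x: "x \<in> X"
  shows "\<exists>Q. P \<subseteq> Q \<and> partial_colour_iso X c Y d Q \<and> x \<in> Domain Q"
proof (cases "x \<in> Domain P")
  case True
  then show ?thesis using P by blast
next
  case False
  interpret X: extensible_colouring X C c by fact
  interpret Y: extensible_colouring Y C d by fact
  have fin: "finite P" and sub: "P \<subseteq> X \<times> Y"
    using P by (auto simp: partial_colour_iso_def)
  \<comment> \<open>For \<open>y\<close> in the range the choice is forced, because \<open>P\<close>
    is a one-to-one matching.\<close>
  define f where "f y = c x (SOME x'. (x', y) \<in> P)" for y
  have f: "f y = c x x'" if "(x', y) \<in> P" for x' y
  proof -
    have "(SOME x'. (x', y) \<in> P) = x'"
      using that partial_colour_isoD(1)[OF P] by blast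
    then show ?thesis by (simp add: f_def)
  qed
  have "f \<in> Range P \<rightarrow> C"
  proof
    fix y assume "y \<in> Range P"
    then obtain x' where "(x', y) \<in> P" by blast
    then show "f y \<in> C" using f sub False x X.colour_in[of x x'] by auto
  qed
  then obtain y where y: "y \<in> Y" "y \<notin> Range P" and dy: "\<And>y'. y' \<in> Range P \<Longrightarrow> d y y' = f y'"
    using Y.extension[of "Range P" f] fin sub finite_Range[of P] by blast
  have new: "d y y' = c x x'" "d y' y = c x' x" if "(x', y') \<in> P" for x' y'
  proof -
    have "y' \<in> Range P" using that by blast
    then show "d y y' = c x x'" using dy f[OF that] by simp
    then show "d y' y = c x' x"
      using that sub x y X.colour_sym[of x x'] Y.colour_sym[of y y'] by auto
  qed
  have "(u = u' \<longleftrightarrow> v = v') \<and> (u \<noteq> u' \<longrightarrow> c u u' = d v v')"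
    if "(u, v) \<in> insert (x, y) P" "(u', v') \<in> insert (x, y) P" for u v u' v'
    using that False y(2) new partial_colour_isoD[OF P, of u v u' v'] by (elim insertE) auto
  then have "partial_colour_iso X c Y d (insert (x, y) P)"
    using fin sub x y unfolding partial_colour_iso_def by auto
  then show ?thesis by blast
qed

lemma partial_colour_iso_back:
  assumes "extensible_colouring X C c" "extensible_colouring Y C d"
    and P: "partial_colour_iso X c Y d P" and y: "y \<in> Y"
  shows "\<exists>Q. P \<subseteq> Q \<and> partial_colour_iso X c Y d Q \<and> y \<in> Range Q"
proof -
  obtain Q where Q: "P\<inverse> \<subseteq> Q" "partial_colour_iso Y d X c Q" "y \<in> Domain Q"
    using partial_colour_iso_forth[OF assms(2,1) partial_colour_iso_converse[OF P] y] by blast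
  then have "P \<subseteq> Q\<inverse>" "y \<in> Range (Q\<inverse>)" by auto
  then show ?thesis using partial_colour_iso_converse[OF Q(2)] by blast
qed

theorem extensible_colouring_unique:
  assumes X: "extensible_colouring X C c" and Y: "extensible_colouring Y C d"
  shows "\<exists>\<theta>. bij_betw \<theta> X Y \<and> (\<forall>x\<in>X. \<forall>x'\<in>X. x \<noteq> x' \<longrightarrow> d (\<theta> x) (\<theta> x') = c x x')"
proof -
  interpret X: extensible_colouring X C c by fact
  interpret Y: extensible_colouring Y C d by fact
  have "X \<noteq> {}" "Y \<noteq> {}" using X.extension[of "{}"] Y.extension[of "{}"] by auto
  define a b where "a = from_nat_into X" and "b = from_nat_into Y"
  have a: "range a = X" and b: "range b = Y"
    using \<open>X \<noteq> {}\<close> \<open>Y \<noteq> {}\<close> X.countable_points Y.countable_points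
    by (auto simp: a_def b_def range_from_nat_into)
  have "\<exists>Q. partial_colour_iso X c Y d Q \<and> P \<subseteq> Q \<and> a n \<in> Domain Q \<and> b n \<in> Range Q"
    if P: "partial_colour_iso X c Y d P" for P n
  proof -
    obtain Q where Q: "P \<subseteq> Q" "partial_colour_iso X c Y d Q" "a n \<in> Domain Q"
      using partial_colour_iso_forth[OF X Y P] a by blast
    obtain R where "Q \<subseteq> R" "partial_colour_iso X c Y d R" "b n \<in> Range R"
      using partial_colour_iso_back[OF X Y Q(2)] b by blast
    then show ?thesis using Q by blast
  qed
  moreover have "partial_colour_iso X c Y d {}" by (simp add: partial_colour_iso_def)
  ultimately obtain P where P: "\<And>n. partial_colour_iso X c Y d (P n)"
    and step: "\<And>n. P n \<subseteq> P (Suc n) \<and> a n \<in> Domain (P (Suc n)) \<and> b n \<in> Range (P (Suc n))"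
    using dependent_nat_choice[of "\<lambda>_. partial_colour_iso X c Y d"
        "\<lambda>n P Q. P \<subseteq> Q \<and> a n \<in> Domain Q \<and> b n \<in> Range Q"] by metis
  \<comment> \<open>The stages increase, so any two pairs of \<open>U\<close> lie in a common stage
    and the pairwise conditions pass to the union. Stage \<open>Suc n\<close> has absorbed
    \<open>a n\<close> and \<open>b n\<close>, which makes \<open>U\<close> total and onto.\<close>
  define U where "U = (\<Union>n. P n)"
  have mono: "P m \<subseteq> P n" if "m \<le> n" for m n
    using that step by (simp add: lift_Suc_mono_le)
  have U: "x = x' \<longleftrightarrow> y = y'" "x \<noteq> x' \<Longrightarrow> c x x' = d y y'"
    if "(x, y) \<in> U" "(x', y') \<in> U" for x y x' y'
  proof -
    obtain m n where "(x, y) \<in> P m" "(x', y') \<in> P n" using \<open>(x, y) \<in> U\<close> \<open>(x', y') \<in> U\<close>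
      by (auto simp: U_def)
    then have "(x, y) \<in> P (max m n)" "(x', y') \<in> P (max m n)"
      using mono[of m "max m n"] mono[of n "max m n"] by auto
    then show "x = x' \<longleftrightarrow> y = y'" "x \<noteq> x' \<Longrightarrow> c x x' = d y y'"
      using partial_colour_isoD[OF P] by blast+
  qed
  have sub: "U \<subseteq> X \<times> Y" using P unfolding U_def partial_colour_iso_def by blast
  have "X \<subseteq> Domain U" "Y \<subseteq> Range U" using step a b unfolding U_def by blast+
  then have "\<forall>x\<in>X. \<exists>y. (x, y) \<in> U" by blast
  then obtain \<theta> where \<theta>: "\<And>x. x \<in> X \<Longrightarrow> (x, \<theta> x) \<in> U" by (auto dest!: bchoice)
  have "inj_on \<theta> X" using \<theta> U(1) by (meson inj_onI)
  moreover have "\<theta> ` X = Y"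
  proof
    show "\<theta> ` X \<subseteq> Y" using \<theta> sub by auto
    show "Y \<subseteq> \<theta> ` X"
    proof
      fix y assume "y \<in> Y"
      then obtain x where "(x, y) \<in> U" using \<open>Y \<subseteq> Range U\<close> by blast
      then have "x \<in> X" "y = \<theta> x" using sub U(1)[of x y x "\<theta> x"] \<theta> by auto
      then show "y \<in> \<theta> ` X" by blast
    qed
  qed
  ultimately show ?thesis
    using \<theta> U(2) unfolding bij_betw_def by metis
qed

section \<open>The freely generated coloured graph\<close>

text \<open>A node stands for the point whose edges to the listed points have the listed colours. Different
  lists may describe the same partial colouring; the resulting points are then distinct twins.\<close>

datatype 'n colour_tree = Atom 'n | Node "('n colour_tree \<times> nat) list"

instance colour_tree :: (countable) countable
  by countable_datatype

fun edge_label :: "'n colour_tree \<Rightarrow> 'n colour_tree \<Rightarrow> nat option"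
  where
    "edge_label (Atom n) t = None"
  | "edge_label (Node l) t = map_of l t"

text \<open>All edges between atoms get the default \<open>0\<close>, so every permutation of the
  atoms respects the colours among them.\<close>

definition tree_colour :: "'n colour_tree \<Rightarrow> 'n colour_tree \<Rightarrow> nat"
  where "tree_colour s t = (case edge_label s t of Some k \<Rightarrow> k
    | None \<Rightarrow> (case edge_label t s of Some k \<Rightarrow> k | None \<Rightarrow> 0))"

lemma size_child: "(t, k) \<in> set l \<Longrightarrow> size t < size (Node l)"
  by (induction l) auto

lemma edge_label_size: "edge_label s t = Some k \<Longrightarrow> size t < size s"
  by (cases s) (auto dest!: map_of_SomeD size_child)

text \<open>Listed children are strictly smaller, so two trees cannot list each other and the order
  of the two lookups is irrelevant.\<close>

lemma tree_colour_sym: "tree_colour s t = tree_colour t s"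
  by (auto simp: tree_colour_def split: option.splits dest!: edge_label_size)

text \<open>Lookup tests subtrees for equality. An injective renaming of atoms is injective on
  trees, so it creates no new matches.\<close>

lemma edge_label_map:
  assumes "inj \<pi>"
  shows "edge_label (map_colour_tree \<pi> s) (map_colour_tree \<pi> t) = edge_label s t"
proof (cases s)
  case (Node l)
  have "map_of (map (map_prod (map_colour_tree \<pi>) id) l) (map_colour_tree \<pi> t) = map_of l t"
    using injD[OF colour_tree.inj_map[OF assms]] by (induction l) auto
  then show ?thesis by (simp add: Node id_def)
qed simp

lemma tree_colour_map:
  assumes "inj \<pi>"
  shows "tree_colour (map_colour_tree \<pi> s) (map_colour_tree \<pi> t) = tree_colour s t"
  by (simp only: tree_colour_def edge_label_map[OF assms])

lemma finite_set_colour_tree: "finite (set_colour_tree t)"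
  by (induction t) (auto simp: prod_set_defs)

text \<open>Trees store colours as numbers. Nonemptiness of \<open>C\<close> lets every number,
  including the default \<open>0\<close>, decode to a colour; countability makes decoding undo
  \<open>to_nat_on\<close>.\<close>

lemma extensible_colour_tree:
  assumes "countable C" "C \<noteq> {}"
  shows "extensible_colouring (UNIV :: 'n::countable colour_tree set) C
    (\<lambda>s t. from_nat_into C (tree_colour s t))"
proof
  fix A :: "'n colour_tree set" and f
  assume "finite A" and f: "f \<in> A \<rightarrow> C"
  obtain as where as: "set as = A" using \<open>finite A\<close> finite_list by blast
  \<comment> \<open>The new point lists every \<open>a\<close> in \<open>A\<close> with the code of
    its required colour. If it belonged to \<open>A\<close>, it would list itself and be smaller
    than itself.\<close>
  define t where "t = Node (map (\<lambda>a. (a, to_nat_on C (f a))) as)"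
  \<comment> \<open>Repeated entries of \<open>as\<close> carry the same code, so it does not matter
    which one \<open>map_of\<close> finds.\<close>
  have label: "edge_label t a = Some (to_nat_on C (f a))" if "a \<in> A" for a
    using that unfolding as[symmetric] t_def by (induction as) auto
  have "t \<notin> A" using label edge_label_size by blast
  moreover have "from_nat_into C (tree_colour t a) = f a" if "a \<in> A" for a
    using that label funcset_mem[OF f] assms(1) by (simp add: tree_colour_def)
  ultimately show "\<exists>x\<in>UNIV - A. \<forall>a\<in>A. from_nat_into C (tree_colour x a) = f a" by blast
qed (use assms in \<open>simp_all add: tree_colour_sym from_nat_into\<close>)

section \<open>Colouring the universal homogeneous echeloned space\<close>

definition (in echeloned_space) echelon :: "'a \<Rightarrow> 'a \<Rightarrow> ('a \<times> 'a) set"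
  where "echelon x y = {p \<in> X \<times> X. (p, (x, y)) \<in> r \<and> ((x, y), p) \<in> r}"

context echeloned_space
begin

lemma refl_pair: "\<lbrakk>x \<in> X; y \<in> X\<rbrakk> \<Longrightarrow> ((x, y), (x, y)) \<in> r"
  using preorder by (auto simp: preorder_on_def refl_on_def)

lemma trans_pairs: "\<lbrakk>(p, q) \<in> r; (q, s) \<in> r\<rbrakk> \<Longrightarrow> (p, s) \<in> r"
  using preorder by (meson preorder_on_def transE)

lemma comparable: "\<lbrakk>p \<in> X \<times> X; q \<in> X \<times> X\<rbrakk> \<Longrightarrow> (p, q) \<in> r \<or> (q, p) \<in> r"
  using total refl_pair[of "fst p" "snd p"] unfolding total_on_def by (cases "p = q") auto

lemma echelon_eq_iff:
  assumes "x \<in> X" "y \<in> X" "z \<in> X" "w \<in> X"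
  shows "echelon x y = echelon z w \<longleftrightarrow> ((x, y), (z, w)) \<in> r \<and> ((z, w), (x, y)) \<in> r"
proof
  assume "echelon x y = echelon z w"
  moreover have "(x, y) \<in> echelon x y" using assms refl_pair by (simp add: echelon_def)
  ultimately show "((x, y), (z, w)) \<in> r \<and> ((z, w), (x, y)) \<in> r" by (simp add: echelon_def)
next
  assume "((x, y), (z, w)) \<in> r \<and> ((z, w), (x, y)) \<in> r"
  then have "(p, (x, y)) \<in> r \<longleftrightarrow> (p, (z, w)) \<in> r" "((x, y), p) \<in> r \<longleftrightarrow> ((z, w), p) \<in> r" for p
    using trans_pairs[of p "(x, y)" "(z, w)"] trans_pairs[of p "(z, w)" "(x, y)"]
      trans_pairs[of "(x, y)" "(z, w)" p] trans_pairs[of "(z, w)" "(x, y)" p] by auto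
  then show "echelon x y = echelon z w" by (simp add: echelon_def)
qed

text \<open>This is why the coloured graph may forget the order between classes: a map that fixes
  every class sends each pair to an equivalent one, and transitivity transfers all comparisons.
  Diagonal pairs are mutually equivalent by \<open>diag_least\<close>.\<close>

lemma ech_embedding_if_echelon_eq:
  assumes "h \<in> X \<rightarrow> X" "inj_on h X"
    and "\<And>x y. \<lbrakk>x \<in> X; y \<in> X; x \<noteq> y\<rbrakk> \<Longrightarrow> echelon (h x) (h y) = echelon x y"
  shows "ech_embedding X r X r h"
  unfolding ech_embedding_def
proof (intro conjI ballI)
  have eq: "((h x, h y), (x, y)) \<in> r" "((x, y), (h x, h y)) \<in> r" if "x \<in> X" "y \<in> X" for x y
  proof -
    have "h x \<in> X" "h y \<in> X" using that assms(1) by auto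
    then have "((h x, h y), (x, y)) \<in> r \<and> ((x, y), (h x, h y)) \<in> r"
      using that assms(3)[of x y] echelon_eq_iff[of "h x" "h y" x y] diag_least by (cases "x = y") auto
    then show "((h x, h y), (x, y)) \<in> r" "((x, y), (h x, h y)) \<in> r" by auto
  qed
  fix x1 y1 x2 y2 assume "x1 \<in> X" "y1 \<in> X" "x2 \<in> X" "y2 \<in> X"
  then show "((x1, y1), (x2, y2)) \<in> r \<longleftrightarrow> ((h x1, h y1), (h x2, h y2)) \<in> r"
    using eq trans_pairs by meson
qed (use assms in auto)

text \<open>The one-point extension of \<open>B\<close> in which the new point \<open>None\<close> lies at distance \<open>p b\<close> from
  \<open>b\<close> is obtained by pulling the preorder back along \<open>q\<close>.\<close>

lemma one_point_extension:
  assumes "B \<subseteq> X" "b0 \<in> B" and p: "\<And>b. b \<in> B \<Longrightarrow> p b \<in> X \<times> X" "\<And>b. b \<in> B \<Longrightarrow> fst (p b) \<noteq> snd (p b)"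
  defines "q \<equiv> \<lambda>u. case u of (Some a, Some b) \<Rightarrow> (a, b) | (None, Some b) \<Rightarrow> p b
    | (Some b, None) \<Rightarrow> p b | (None, None) \<Rightarrow> (b0, b0)"
  defines "Y \<equiv> insert None (Some ` B)"
  shows "echeloned_space Y {(u, v). u \<in> Y \<times> Y \<and> v \<in> Y \<times> Y \<and> (q u, q v) \<in> r}"
proof -
  have q: "q u \<in> X \<times> X" if "u \<in> Y \<times> Y" for u
    using that p(1) assms(1,2) unfolding q_def Y_def by (auto split: option.splits)
  \<comment> \<open>On pairs from \<open>Y\<close>, \<open>q\<close> hits the diagonal exactly at
    diagonal pairs, and reversing a pair fixes or swaps its image. These facts pull each axiom back
    from \<open>X\<close>.\<close>
  have diag: "fst (q (x, x)) = snd (q (x, x))" for x by (simp add: q_def split: option.splits)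
  have off: "fst (q (y, z)) = snd (q (y, z)) \<Longrightarrow> y = z" if "y \<in> Y" "z \<in> Y" for y z
    using that p(2) unfolding q_def Y_def by (auto split: option.splits)
  have sym: "q (y, z) = q (z, y) \<or> q (y, z) = prod.swap (q (z, y))" for y z
    unfolding q_def by (auto split: option.splits)
  have rq: "(q u, q u) \<in> r" if "u \<in> Y \<times> Y" for u
    using q[OF that] refl_pair by (cases "q u") auto
  show ?thesis
  proof
    show "Y \<noteq> {}" by (simp add: Y_def)
    show "preorder_on (Y \<times> Y) {(u, v). u \<in> Y \<times> Y \<and> v \<in> Y \<times> Y \<and> (q u, q v) \<in> r}"
      unfolding preorder_on_def
    proof (intro conjI)
      show "{(u, v). u \<in> Y \<times> Y \<and> v \<in> Y \<times> Y \<and> (q u, q v) \<in> r} \<subseteq> (Y \<times> Y) \<times> (Y \<times> Y)" by blast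
      show "refl_on (Y \<times> Y) {(u, v). u \<in> Y \<times> Y \<and> v \<in> Y \<times> Y \<and> (q u, q v) \<in> r}"
        using rq by (intro refl_onI) simp
      show "trans {(u, v). u \<in> Y \<times> Y \<and> v \<in> Y \<times> Y \<and> (q u, q v) \<in> r}"
        by (intro transI) (use trans_pairs in blast)
    qed
    show "total_on (Y \<times> Y) {(u, v). u \<in> Y \<times> Y \<and> v \<in> Y \<times> Y \<and> (q u, q v) \<in> r}"
      using comparable[OF q q] unfolding total_on_def by blast
  next
    fix x y z assume Y: "x \<in> Y" "y \<in> Y" "z \<in> Y"
    then have X: "q (x, x) \<in> X \<times> X" "q (y, z) \<in> X \<times> X" using q by auto
    obtain w where w: "q (x, x) = (w, w)" using diag[of x] by (metis prod.collapse)
    show "((x, x), (y, z)) \<in> {(u, v). u \<in> Y \<times> Y \<and> v \<in> Y \<times> Y \<and> (q u, q v) \<in> r}"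
      using Y X w diag_least by (cases "q (y, z)") auto
    show "y = z" if "((y, z), (x, x)) \<in> {(u, v). u \<in> Y \<times> Y \<and> v \<in> Y \<times> Y \<and> (q u, q v) \<in> r}"
      using that off[OF Y(2,3)] X w diag_only_least[of w] by (cases "q (y, z)") auto
  next
    fix y z assume Y: "y \<in> Y" "z \<in> Y"
    then have X: "q (z, y) \<in> X \<times> X" using q by auto
    then have "(q (y, z), q (z, y)) \<in> r"
      using sym[of y z] symmetric refl_pair by (cases "q (z, y)") auto
    then show "((y, z), (z, y)) \<in> {(u, v). u \<in> Y \<times> Y \<and> v \<in> Y \<times> Y \<and> (q u, q v) \<in> r}"
      using Y by auto
  qed
qed

end

text \<open>The diagonal class is left out, since no point distinct from \<open>a\<close> can lie at
  distance zero from \<open>a\<close>.\<close>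

definition (in echeloned_space) echelons :: "('a \<times> 'a) set set"
  where "echelons = {echelon x y |x y. x \<in> X \<and> y \<in> X \<and> x \<noteq> y}"

section \<open>The extension property for echelons\<close>

context universal_homogeneous_echeloned_space
begin

text \<open>Universality embeds the one-point extension, and homogeneity moves its copy of
  \<open>B\<close> back onto \<open>B\<close>; the image of \<open>None\<close> is the desired
  point. Taking \<open>p b\<close> inside \<open>B \<times> B\<close> lets this finite space itself
  record the class of each new edge.\<close>

lemma realise_echelons:
  assumes B: "finite B" "B \<subseteq> X" "B \<noteq> {}"
    and p: "\<And>b. b \<in> B \<Longrightarrow> p b \<in> B \<times> B" "\<And>b. b \<in> B \<Longrightarrow> fst (p b) \<noteq> snd (p b)"
  shows "\<exists>x\<in>X - B. \<forall>b\<in>B. echelon x b = echelon (fst (p b)) (snd (p b))"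
proof -
  obtain b0 where b0: "b0 \<in> B" using B by blast
  define q where "q = (\<lambda>u. case u of (Some a, Some b) \<Rightarrow> (a, b) | (None, Some b) \<Rightarrow> p b
    | (Some b, None) \<Rightarrow> p b | (None, None) \<Rightarrow> (b0, b0))"
  define Y where "Y = insert None (Some ` B)"
  define s where "s = {(u, v). u \<in> Y \<times> Y \<and> v \<in> Y \<times> Y \<and> (q u, q v) \<in> r}"
  have pX: "p b \<in> X \<times> X" if "b \<in> B" for b using p(1)[OF that] B(2) by auto
  have "echeloned_space Y s"
    unfolding s_def Y_def q_def by (rule one_point_extension[OF B(2) b0]) (use p(2) pX in auto)
  moreover have "finite Y" using B by (simp add: Y_def)
  ultimately obtain h where h: "ech_embedding Y s X r h" using universal_finite by blast
  define A where "A = (h \<circ> Some) ` B"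
  define k where "k = inv_into B (h \<circ> Some)"
  have hX: "h y \<in> X" if "y \<in> Y" for y using h that by (auto simp: ech_embedding_def)
  have hinj: "inj_on h Y" using h by (simp add: ech_embedding_def)
  have hr: "((u, v), (u', v')) \<in> s \<longleftrightarrow> ((h u, h v), (h u', h v')) \<in> r"
    if "u \<in> Y" "v \<in> Y" "u' \<in> Y" "v' \<in> Y" for u v u' v'
    using h that by (simp add: ech_embedding_def)
  have inj: "inj_on (h \<circ> Some) B"
    using hinj by (auto simp: inj_on_def Y_def)
  have k: "k (h (Some b)) = b" if "b \<in> B" for b
    using inv_into_f_f[OF inj that] by (simp add: k_def)
  have A: "A \<subseteq> X" "finite A" "A \<noteq> {}" using B hX by (auto simp: A_def Y_def)
  have "ech_iso A (ech_restrict r A) B (ech_restrict r B) k"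
    unfolding ech_iso_def ech_embedding_def
  proof (intro conjI ballI)
    show "k \<in> A \<rightarrow> B" "inj_on k A" "k ` A = B"
      using k by (auto simp: A_def inj_on_def image_image)
    fix x1 y1 x2 y2 assume "x1 \<in> A" "y1 \<in> A" "x2 \<in> A" "y2 \<in> A"
    then obtain a b c d where eqs: "x1 = h (Some a)" "y1 = h (Some b)" "x2 = h (Some c)"
      "y2 = h (Some d)" and B': "a \<in> B" "b \<in> B" "c \<in> B" "d \<in> B"
      by (auto simp: A_def)
    have "((h (Some a), h (Some b)), (h (Some c), h (Some d))) \<in> r \<longleftrightarrow> ((a, b), (c, d)) \<in> r"
      using hr[of "Some a" "Some b" "Some c" "Some d"] B' by (auto simp: Y_def s_def q_def)
    then show "((x1, y1), (x2, y2)) \<in> ech_restrict r A \<longleftrightarrow>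
        ((k x1, k y1), (k x2, k y2)) \<in> ech_restrict r B"
      using B' by (auto simp: eqs k ech_restrict_def A_def)
  qed
  then obtain g where g: "g \<in> ech_Aut X r" and gk: "\<And>x. x \<in> A \<Longrightarrow> g x = k x"
    using homogeneous[OF A B(2,1,3)] by blast
  have gX: "g x \<in> X" if "x \<in> X" for x
    using g that by (auto simp: ech_Aut_def ech_embedding_def)
  have ginj: "inj_on g X" using g by (auto simp: ech_Aut_def ech_embedding_def)
  have gr: "((u, v), (u', v')) \<in> r \<longleftrightarrow> ((g u, g v), (g u', g v')) \<in> r"
    if "u \<in> X" "v \<in> X" "u' \<in> X" "v' \<in> X" for u v u' v'
    using g that by (auto simp: ech_Aut_def ech_embedding_def)
  have gh: "g (h (Some b)) = b" if "b \<in> B" for b using that gk k by (simp add: A_def)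
  define x where "x = g (h None)"
  have NY: "None \<in> Y" and SY: "\<And>b. b \<in> B \<Longrightarrow> Some b \<in> Y" by (auto simp: Y_def)
  have "x \<in> X" using gX hX NY by (simp add: x_def)
  moreover have "x \<notin> B"
  proof
    assume "x \<in> B"
    then have "g (h None) = g (h (Some x))" using gh by (simp add: x_def)
    then show False
      using inj_onD[OF ginj] inj_onD[OF hinj] hX NY SY[OF \<open>x \<in> B\<close>] by blast
  qed
  moreover have "echelon x b = echelon (fst (p b)) (snd (p b))" if b: "b \<in> B" for b
  proof -
    obtain c d where cd: "p b = (c, d)" "c \<in> B" "d \<in> B" using p(1)[OF b] by auto
    have r: "((c, d), (c, d)) \<in> r" using cd B(2) refl_pair by auto
    \<comment> \<open>Both pairs have the same image \<open>(c, d)\<close> under \<open>q\<close>,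
      hence they are equivalent in \<open>s\<close>; \<open>h\<close> followed by \<open>g\<close>
      carries this to \<open>r\<close>.\<close>
    have "((None, Some b), (Some c, Some d)) \<in> s" "((Some c, Some d), (None, Some b)) \<in> s"
      using r b cd NY SY by (auto simp: s_def q_def)
    then have "((x, b), (c, d)) \<in> r \<and> ((c, d), (x, b)) \<in> r"
      using hr gr hX NY SY b cd gh unfolding x_def by metis
    moreover have "b \<in> X" "c \<in> X" "d \<in> X" using b cd B(2) by auto
    ultimately show ?thesis using echelon_eq_iff[OF \<open>x \<in> X\<close>] cd by simp
  qed
  ultimately show ?thesis by blast
qed

lemma extensible_echelon: "extensible_colouring X echelons echelon"
proof
  fix x y assume "x \<in> X" "y \<in> X"
  then show "echelon x y = echelon y x" by (simp add: echelon_eq_iff symmetric)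
  show "echelon x y \<in> echelons" if "x \<noteq> y"
    using \<open>x \<in> X\<close> \<open>y \<in> X\<close> that unfolding echelons_def by blast
next
  show "countable X" by (rule countable)
next
  fix A and f assume A: "finite A" "A \<subseteq> X" and f: "f \<in> A \<rightarrow> echelons"
  show "\<exists>x\<in>X - A. \<forall>a\<in>A. echelon x a = f a"
  proof (cases "A = {}")
    case True
    then show ?thesis using nonempty by auto
  next
    case False
    then obtain a0 where a0: "a0 \<in> A" by blast
    have "\<forall>a\<in>A. \<exists>p \<in> X \<times> X. fst p \<noteq> snd p \<and> echelon (fst p) (snd p) = f a"
      using f unfolding echelons_def by fastforce
    then obtain p where p: "\<And>a. a \<in> A \<Longrightarrow> p a \<in> X \<times> X" "\<And>a. a \<in> A \<Longrightarrow> fst (p a) \<noteq> snd (p a)"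
      "\<And>a. a \<in> A \<Longrightarrow> echelon (fst (p a)) (snd (p a)) = f a" by metis
    \<comment> \<open>\<open>A\<close> is enlarged by the endpoints of pairs representing the
      required classes. Points of \<open>B\<close> outside \<open>A\<close> may receive any class,
      here that of \<open>p a0\<close>.\<close>
    define B where "B = A \<union> fst ` p ` A \<union> snd ` p ` A"
    define p' where "p' b = (if b \<in> A then p b else p a0)" for b
    have "finite B" "B \<subseteq> X" "B \<noteq> {}" using A a0 p(1) by (fastforce simp: B_def)+
    moreover have "p' b \<in> B \<times> B" "fst (p' b) \<noteq> snd (p' b)" for b
      using a0 p(2) by (auto simp: p'_def B_def mem_Times_iff)
    ultimately obtain x where "x \<in> X - B" "\<forall>b\<in>B. echelon x b = echelon (fst (p' b)) (snd (p' b))"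
      using realise_echelons[of B p'] by blast
    then have "x \<in> X - A \<and> (\<forall>a\<in>A. echelon x a = f a)" using p(3) by (simp add: B_def p'_def)
    then show ?thesis by blast
  qed
qed

lemma echelons_nonempty: "echelons \<noteq> {}"
proof -
  \<comment> \<open>A two-point space, whose embedding yields two distinct points of
    \<open>X\<close>.\<close>
  define s :: "(nat \<times> nat) rel" where
    "s = {((a, b), (c, d)). {a, b, c, d} \<subseteq> {0, 1} \<and> (a \<noteq> b \<longrightarrow> c \<noteq> d)}"
  have "echeloned_space {0, 1} s"
    by unfold_locales
      (auto simp: s_def preorder_on_def refl_on_def total_on_def trans_def)
  then obtain h where "ech_embedding {0, 1} s X r h" using universal_nat[of "{0, 1}"] by auto
  then have "h 0 \<in> X" "h 1 \<in> X" "h 0 \<noteq> h 1" by (auto simp: ech_embedding_def)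
  then show ?thesis unfolding echelons_def by blast
qed

lemma countable_echelons: "countable echelons"
proof (rule countable_subset)
  show "echelons \<subseteq> (\<lambda>(x, y). echelon x y) ` (X \<times> X)" by (auto simp: echelons_def)
  show "countable ((\<lambda>(x, y). echelon x y) ` (X \<times> X))" using countable by simp
qed

end

section \<open>The action by renaming\<close>

lemma continuous_map_pointwise_topologyI:
  assumes "\<And>x. x \<in> X \<Longrightarrow> continuous_map T (discrete_topology X) (\<lambda>g. f g x)"
    and "\<And>g. g \<in> topspace T \<Longrightarrow> f g \<in> G" "G \<subseteq> Bij X"
  shows "continuous_map T (pointwise_topology X G) f"
  unfolding pointwise_topology_def
proof (rule continuous_map_into_subtopology)
  show "f \<in> topspace T \<rightarrow> G" using assms(2) by blast
  have "f g \<in> extensional X" if "g \<in> topspace T" for g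
    using assms(2)[OF that] assms(3) by (auto simp: Bij_def)
  then show "continuous_map T (product_topology (\<lambda>_. discrete_topology X) X) f"
    using assms(1) by (auto simp: continuous_map_componentwise)
qed

lemma continuous_map_pointwise_eval:
  assumes "x \<in> X"
  shows "continuous_map (pointwise_topology X G) (discrete_topology X) (\<lambda>g. g x)"
  unfolding pointwise_topology_def
  using assms by (intro continuous_map_from_subtopology continuous_map_product_projection)

lemma openin_agreement:
  assumes "finite N" "N \<subseteq> X" "G \<subseteq> Bij X" "g0 \<in> G"
  shows "openin (pointwise_topology X G) {g \<in> G. \<forall>n\<in>N. g n = g0 n}"
proof -
  have "openin (pointwise_topology X G) {g \<in> topspace (pointwise_topology X G). g n \<in> {g0 n}}"
    if "n \<in> N" for n
  proof (rule openin_continuous_map_preimage[OF continuous_map_pointwise_eval])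
    show "n \<in> X" using that assms by blast
    then show "openin (discrete_topology X) {g0 n}"
      using assms(3,4) by (auto simp: Bij_def bij_betw_def)
  qed
  then have "openin (pointwise_topology X G) {g \<in> G. g n = g0 n}" if "n \<in> N" for n
    using that by (simp add: topspace_pointwise_topology[OF assms(3)])
  moreover have "openin (pointwise_topology X G) G"
    using openin_topspace[of "pointwise_topology X G"]
    by (simp add: topspace_pointwise_topology[OF assms(3)])
  ultimately have "openin (pointwise_topology X G) (G \<inter> (\<Inter>n\<in>N. {g \<in> G. g n = g0 n}))"
    using assms(1) by (cases "N = {}") (auto intro!: openin_Int openin_INT)
  moreover have "G \<inter> (\<Inter>n\<in>N. {g \<in> G. g n = g0 n}) = {g \<in> G. \<forall>n\<in>N. g n = g0 n}" by auto
  ultimately show ?thesis by simp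
qed

text \<open>Agreement with \<open>g\<close> on \<open>N\<close> defines an open neighbourhood of
  \<open>g\<close> on which \<open>f\<close> is constant; thus \<open>f\<close> is locally
  constant.\<close>

lemma continuous_map_finite_dependence:
  assumes "finite N" "N \<subseteq> X" "G \<subseteq> Bij X" and f: "\<And>g. g \<in> G \<Longrightarrow> f g \<in> D"
    and dep: "\<And>g h. \<lbrakk>g \<in> G; h \<in> G; \<forall>n\<in>N. g n = h n\<rbrakk> \<Longrightarrow> f g = f h"
  shows "continuous_map (pointwise_topology X G) (discrete_topology D) f"
  unfolding continuous_map_def topspace_pointwise_topology[OF assms(3)]
proof (intro conjI allI impI)
  show "f \<in> G \<rightarrow> topspace (discrete_topology D)" using f by simp
  fix U
  have "\<exists>T. openin (pointwise_topology X G) T \<and> g \<in> T \<and> T \<subseteq> {g \<in> G. f g \<in> U}"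
    if g: "g \<in> G" "f g \<in> U" for g
  proof (intro exI conjI)
    show "openin (pointwise_topology X G) {h \<in> G. \<forall>n\<in>N. h n = g n}"
      using assms(1-3) g(1) by (rule openin_agreement)
    show "{h \<in> G. \<forall>n\<in>N. h n = g n} \<subseteq> {g \<in> G. f g \<in> U}"
    proof clarify
      fix h assume "h \<in> G" "\<forall>n\<in>N. h n = g n"
      then show "f h \<in> U" using dep[of h g] g by simp
    qed
  qed (use g in auto)
  then show "openin (pointwise_topology X G) {g \<in> G. f g \<in> U}"
    by (subst openin_subopen) blast
qed

section \<open>Transport of the renaming action to \<open>X\<close>\<close>

definition tree_action :: "'a set \<Rightarrow> ('n colour_tree \<Rightarrow> 'a) \<Rightarrow> ('n \<Rightarrow> 'n) \<Rightarrow> 'a \<Rightarrow> 'a"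
  where "tree_action X \<theta> \<pi> = (\<lambda>x\<in>X. \<theta> (map_colour_tree \<pi> (the_inv \<theta> x)))"

lemma tree_action_apply:
  assumes "bij_betw \<theta> UNIV X"
  shows "tree_action X \<theta> \<pi> (\<theta> t) = \<theta> (map_colour_tree \<pi> t)"
  using assms by (auto simp: tree_action_def bij_betw_def the_inv_f_f)

lemma tree_action_compose:
  assumes "bij_betw \<theta> UNIV X"
  shows "tree_action X \<theta> (\<pi> \<circ> \<rho>) = compose X (tree_action X \<theta> \<pi>) (tree_action X \<theta> \<rho>)"
proof (rule extensionalityI)
  fix x assume "x \<in> X"
  then obtain t where "x = \<theta> t" using assms by (auto simp: bij_betw_def)
  then show "tree_action X \<theta> (\<pi> \<circ> \<rho>) x = compose X (tree_action X \<theta> \<pi>) (tree_action X \<theta> \<rho>) x"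
    using \<open>x \<in> X\<close> by (simp add: compose_eq tree_action_apply[OF assms] colour_tree.map_comp)
qed (simp_all add: tree_action_def)

lemma tree_action_Bij:
  assumes \<theta>: "bij_betw \<theta> UNIV X" and \<pi>: "bij \<pi>"
  shows "tree_action X \<theta> \<pi> \<in> Bij X"
proof -
  have "map_colour_tree \<pi> (map_colour_tree (inv_into UNIV \<pi>) t) = t" for t
    using \<pi> by (simp add: colour_tree.map_comp bij_is_surj surj_iff[THEN iffD1] colour_tree.map_id)
  then have "surj (map_colour_tree \<pi>)" by (metis surjI)
  moreover have "inj (map_colour_tree \<pi>)" using \<pi> by (simp add: bij_is_inj colour_tree.inj_map)
  ultimately have "bij (map_colour_tree \<pi>)" by (simp add: bij_def)
  then have "bij_betw (\<theta> \<circ> map_colour_tree \<pi>) UNIV X" using \<theta> by (rule bij_betw_trans)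
  moreover have "bij_betw (the_inv \<theta>) X UNIV"
    using bij_betw_the_inv_into[OF \<theta>] by simp
  ultimately have "bij_betw (\<theta> \<circ> map_colour_tree \<pi> \<circ> the_inv \<theta>) X X"
    by (metis bij_betw_trans)
  then have "bij_betw (tree_action X \<theta> \<pi>) X X"
    by (rule bij_betw_cong[THEN iffD1, rotated]) (simp add: tree_action_def)
  then show ?thesis by (simp add: Bij_def tree_action_def)
qed

lemma Bij_UNIV: "Bij UNIV = {\<pi>. bij \<pi>}"
  by (auto simp: Bij_def extensional_def)

text \<open>Continuity holds because the value at \<open>\<theta> t\<close> depends on
  \<open>\<pi>\<close> only at the finitely many atoms of \<open>t\<close>. The inverse is
  continuous because \<open>\<pi> n\<close> can be read off from the value at the single point
  \<open>\<theta> (Atom n)\<close>.\<close>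

lemma embedding_map_tree_action:
  fixes \<theta> :: "'n colour_tree \<Rightarrow> 'a"
  assumes \<theta>: "bij_betw \<theta> UNIV X" and H: "H \<subseteq> Bij X"
    and into: "\<And>\<pi>. bij \<pi> \<Longrightarrow> tree_action X \<theta> \<pi> \<in> H"
  shows "embedding_map (pointwise_topology UNIV (Bij UNIV)) (pointwise_topology X H)
    (tree_action X \<theta>)"
proof -
  let ?S = "pointwise_topology (UNIV :: 'n set) (Bij UNIV)"
  let ?T = "pointwise_topology X H"
  let ?\<phi> = "tree_action X \<theta>"
  have tS: "topspace ?S = Bij UNIV" by (simp add: topspace_pointwise_topology)
  \<comment> \<open>On the image of the action, atoms go to atoms, so the \<open>Node\<close> case
    does not arise there.\<close>
  define \<psi> where "\<psi> g n = (case the_inv \<theta> (g (\<theta> (Atom n))) of Atom m \<Rightarrow> m | Node _ \<Rightarrow> undefined)"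
    for g :: "'a \<Rightarrow> 'a" and n
  have \<psi>\<phi>: "\<psi> (?\<phi> \<pi>) = \<pi>" for \<pi>
    using \<theta> by (simp add: fun_eq_iff \<psi>_def tree_action_apply[OF \<theta>] bij_betw_def the_inv_f_f)
  have \<theta>X: "\<theta> t \<in> X" for t using \<theta> by (auto simp: bij_betw_def)
  have "homeomorphic_maps ?S (subtopology ?T (?\<phi> ` topspace ?S)) ?\<phi> \<psi>"
    unfolding homeomorphic_maps_def
  proof (intro conjI ballI)
    have "continuous_map ?S ?T ?\<phi>"
    proof (rule continuous_map_pointwise_topologyI[OF _ _ H])
      fix x assume "x \<in> X"
      then obtain t where t: "x = \<theta> t" using \<theta> by (auto simp: bij_betw_def)
      show "continuous_map ?S (discrete_topology X) (\<lambda>\<pi>. ?\<phi> \<pi> x)"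
      proof (rule continuous_map_finite_dependence)
        show "finite (set_colour_tree t)" by (rule finite_set_colour_tree)
        fix \<pi> \<rho> :: "'n \<Rightarrow> 'n" assume "\<forall>n\<in>set_colour_tree t. \<pi> n = \<rho> n"
        then show "?\<phi> \<pi> x = ?\<phi> \<rho> x"
          by (simp add: t tree_action_apply[OF \<theta>] cong: colour_tree.map_cong)
      qed (simp_all add: t tree_action_apply[OF \<theta>] \<theta>X)
    qed (metis tS Bij_UNIV into mem_Collect_eq)
    then show "continuous_map ?S (subtopology ?T (?\<phi> ` topspace ?S)) ?\<phi>"
      by (simp add: continuous_map_in_subtopology)
    show "continuous_map (subtopology ?T (?\<phi> ` topspace ?S)) ?S \<psi>"
    proof (rule continuous_map_pointwise_topologyI)
      fix n :: 'n
      \<comment> \<open>Any function on a discrete space is continuous, so the value of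
        \<open>decode\<close> at nodes is harmless.\<close>
      define decode where "decode y = (case the_inv \<theta> y of Atom m \<Rightarrow> m | Node _ \<Rightarrow> undefined)" for y
      have "continuous_map ?T (discrete_topology UNIV) (decode \<circ> (\<lambda>g. g (\<theta> (Atom n))))"
        using continuous_map_pointwise_eval[OF \<theta>X]
        by (rule continuous_map_compose) simp
      moreover have "decode \<circ> (\<lambda>g. g (\<theta> (Atom n))) = (\<lambda>g. \<psi> g n)"
        by (auto simp: decode_def \<psi>_def)
      ultimately show "continuous_map (subtopology ?T (?\<phi> ` topspace ?S)) (discrete_topology UNIV)
          (\<lambda>g. \<psi> g n)"
        by (simp add: continuous_map_from_subtopology)
    qed (auto simp: tS \<psi>\<phi>)
  qed (auto simp: \<psi>\<phi>)
  then show ?thesis unfolding embedding_map_def by (rule homeomorphic_maps_imp_map)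
qed

theorem theorem5p1:
  fixes X :: "'a set" and r :: "('a \<times> 'a) rel"
  assumes "universal_homogeneous_echeloned_space X r"
  shows "\<exists>\<phi>. topological_group_embedding
    (BijGroup (UNIV :: nat set)) (pointwise_topology UNIV (Bij UNIV))
    (ech_AutGroup X r) (pointwise_topology X (ech_Aut X r)) \<phi>"
proof -
  interpret universal_homogeneous_echeloned_space X r by fact
  \<comment> \<open>Trees and \<open>X\<close> are extensible over the same colour set
    \<open>echelons\<close>, so back-and-forth identifies them.\<close>
  obtain \<theta> :: "nat colour_tree \<Rightarrow> 'a" where \<theta>: "bij_betw \<theta> UNIV X"
    and colour: "\<And>s t. s \<noteq> t \<Longrightarrow> echelon (\<theta> s) (\<theta> t) = from_nat_into echelons (tree_colour s t)"
    using extensible_colouring_unique[OF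
        extensible_colour_tree[OF countable_echelons echelons_nonempty] extensible_echelon]
    by blast
  \<comment> \<open>Renaming preserves tree colours, which \<open>\<theta>\<close> turns into
    echelons; preserving echelons suffices for an automorphism.\<close>
  have Aut: "tree_action X \<theta> \<pi> \<in> ech_Aut X r" if \<pi>: "bij \<pi>" for \<pi>
  proof -
    have Bij: "tree_action X \<theta> \<pi> \<in> Bij X" using \<theta> \<pi> by (rule tree_action_Bij)
    have "ech_embedding X r X r (tree_action X \<theta> \<pi>)"
    proof (rule ech_embedding_if_echelon_eq)
      show "tree_action X \<theta> \<pi> \<in> X \<rightarrow> X" "inj_on (tree_action X \<theta> \<pi>) X"
        using Bij by (auto simp: Bij_def bij_betw_def)
      fix x y assume "x \<in> X" "y \<in> X" "x \<noteq> y"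
      then obtain s t where st: "x = \<theta> s" "y = \<theta> t" "s \<noteq> t" using \<theta> by (auto simp: bij_betw_def)
      then have "map_colour_tree \<pi> s \<noteq> map_colour_tree \<pi> t"
        using injD[OF colour_tree.inj_map[OF bij_is_inj[OF \<pi>]]] by blast
      then show "echelon (tree_action X \<theta> \<pi> x) (tree_action X \<theta> \<pi> y) = echelon x y"
        by (simp add: st tree_action_apply[OF \<theta>] colour tree_colour_map[OF bij_is_inj[OF \<pi>]])
    qed
    then show ?thesis using Bij by (simp add: ech_Aut_def)
  qed
  have "tree_action X \<theta> \<in> hom (BijGroup UNIV) (ech_AutGroup X r)"
  proof (rule homI)
    fix \<pi> \<rho> :: "nat \<Rightarrow> nat" assume "\<pi> \<in> carrier (BijGroup UNIV)" "\<rho> \<in> carrier (BijGroup UNIV)"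
    then have "bij \<pi>" "bij \<rho>" by (auto simp: BijGroup_def Bij_UNIV)
    moreover have "compose UNIV \<pi> \<rho> = \<pi> \<circ> \<rho>" by (auto simp: compose_def)
    ultimately show "tree_action X \<theta> (\<pi> \<otimes>\<^bsub>BijGroup UNIV\<^esub> \<rho>) =
        tree_action X \<theta> \<pi> \<otimes>\<^bsub>ech_AutGroup X r\<^esub> tree_action X \<theta> \<rho>"
      using tree_action_Bij[OF \<theta>]
      by (simp add: BijGroup_def ech_AutGroup_def Bij_UNIV tree_action_compose[OF \<theta>])
  qed (simp add: BijGroup_def ech_AutGroup_def Bij_UNIV Aut)
  moreover have "embedding_map (pointwise_topology UNIV (Bij UNIV))
      (pointwise_topology X (ech_Aut X r)) (tree_action X \<theta>)"
    using \<theta> _ Aut by (rule embedding_map_tree_action) (auto simp: ech_Aut_def)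
  ultimately show ?thesis unfolding topological_group_embedding_def by blast
qed

end
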